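(* Taking suprema over all edge probability measures $\mu$ (on all finite complete graphs), \begin{align*} \sup_{\mu}\Bigl(2\sum_{e\in\operatorname{supp}\mu}\mu(e)^2+\beta(\mu;P_3)\Bigr) &= 2,\\ \sup_{\mu}\bigl(2m\cdot\beta(\mu;C_m)+\beta(\mu;P_{m+1})\bigr) &= \frac{2}{m^{m-1}}\quad\text{for } m\in\{3,4\},\\ \sup_{\mu}\bigl(2m\cdot\beta(\mu;C_m)+\beta(\mu;P_{m+1})\bigr) &< \frac{2.7}{m^{m-1}}\quad\text{for all integers } m\ge 5. \end{align*}
   Context: $C_k$ is the cycle on $k$ vertices and $P_k$ is the path on $k$ vertices. An edge probability measure is a probability measure $\mu$ on the edge set $E(K)$ of some finite complete graph $K$; $\operatorname{supp}\mu$ is the set of edges of positive mass. For a subgraph $H'\subseteq K$, $\mu(H')=\prod_{e\in E(H')}\mu(e)$, and for a graph $H$, $\beta(\mu;H)=\sum_{H'}\mu(H')$, the sum over all (unlabeled, not necessarily induced) subgraphs $H'$ of $K$ isomorphic to $H$. *)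

theory Defs
  imports Complex_Main
begin

definition K_edges :: "nat \<Rightarrow> nat set set" where
  "K_edges n = {e. \<exists>u v. u < n \<and> v < n \<and> u \<noteq> v \<and> e = {u, v}}"

definition edge_prob_measure :: "nat \<Rightarrow> (nat set \<Rightarrow> real) \<Rightarrow> bool" where
  "edge_prob_measure n \<mu> \<longleftrightarrow> (\<forall>e\<in>K_edges n. 0 \<le> \<mu> e) \<and> (\<Sum>e\<in>K_edges n. \<mu> e) = 1"

definition supp_mu :: "nat \<Rightarrow> (nat set \<Rightarrow> real) \<Rightarrow> nat set set" where
  "supp_mu n \<mu> = {e \<in> K_edges n. 0 < \<mu> e}"

definition mu_sub :: "(nat set \<Rightarrow> real) \<Rightarrow> nat set set \<Rightarrow> real" where
  "mu_sub \<mu> F = (\<Prod>e\<in>F. \<mu> e)"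

text \<open>Edge sets of the subgraphs of K_n isomorphic to the path P_k (k vertices).
  Since P_k (k \<ge> 2) has no isolated vertices, such a subgraph is determined by its edge set.\<close>
definition path_subgraphs :: "nat \<Rightarrow> nat \<Rightarrow> nat set set set" where
  "path_subgraphs n k = {F. \<exists>vs. length vs = k \<and> distinct vs \<and> set vs \<subseteq> {..<n} \<and>
      F = {{vs ! i, vs ! (i + 1)} | i. i + 1 < k}}"

definition cycle_subgraphs :: "nat \<Rightarrow> nat \<Rightarrow> nat set set set" where
  "cycle_subgraphs n m = {F. \<exists>vs. length vs = m \<and> distinct vs \<and> set vs \<subseteq> {..<n} \<and>
      F = {{vs ! i, vs ! ((i + 1) mod m)} | i. i < m}}"

definition beta_path :: "nat \<Rightarrow> (nat set \<Rightarrow> real) \<Rightarrow> nat \<Rightarrow> real" where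
  "beta_path n \<mu> k = (\<Sum>F\<in>path_subgraphs n k. mu_sub \<mu> F)"

definition beta_cycle :: "nat \<Rightarrow> (nat set \<Rightarrow> real) \<Rightarrow> nat \<Rightarrow> real" where
  "beta_cycle n \<mu> m = (\<Sum>F\<in>cycle_subgraphs n m. mu_sub \<mu> F)"

end

theory Submission
  imports Defs "HOL-Analysis.Function_Topology"
begin

text \<open>Fix $n$ and let $\mu$ maximise $F = 2m\beta(\mu;C_m) + \beta(\mu;P_{m+1})$, a homogeneous polynomial of
  degree $m$ that is linear in each edge weight. Stationarity at an edge $xy$ of maximal weight $t$ gives
  $mF = \partial F/\partial\mu(xy) \le 2mS + \sum_{i<m} D_i$, where $S$ is the weight of the $x$-$y$ paths with
  $m-1$ edges and $D_i$ that of the pairs of disjoint paths starting at $x$ and $y$ with $i$ and $m-1-i$ edges,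
  all avoiding the edge $xy$. Put $q = (1-t)/(m-1)$. Revealing the paths vertex by vertex and applying AM-GM
  gives $S + D_i + D_{i+1} \le q^{m-1}$, and, since all weights are at most $t$, also $S \le t q^{m-2}$.
  Hence $F \le 2S + \lceil m/2 \rceil (q^{m-1} - S)/m$, and it remains to maximise over $t$.\<close>

section \<open>Optimisation of multilinear forms on a simplex\<close>

text \<open>Stationarity makes the problem local: F mixes all cycles and paths, but at a maximiser m
  F equals a derivative that only sees paths tied to the two ends of one edge. The heaviest edge is
  the right choice because every other weight is then at most t, which gives the second bound on S.
  The weights S, D_i and D_{i+1} share one bound because they obey the same recursion when a vertex
  is revealed and start from masses of disjoint sets of edges. The factor ceil(m/2) comes from
  grouping the D_i into consecutive pairs.

  The uniform measure on an m-cycle has t = q = 1/m and S = q^{m-1}, for which the final estimate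
  equals 2/m^{m-1}. For m = 3 and m = 4 the one-variable bound is maximal at t = 1/m. For m \<ge> 5
  its maximum moves to some t < 1/m and exceeds 2/m^{m-1}, so only a larger constant comes out. The
  claim about P_3 is separate: it follows from expanding the square of the total mass.\<close>

text \<open>AM-GM for one factor \<open>d\<close> and \<open>k\<close> equal factors
  \<open>r / k\<close>. In the inductions below, \<open>d\<close> is the mass at the vertex being
  left and \<open>r\<close> the mass available to the other \<open>k\<close> edges.\<close>

lemma power_mean_step:
  fixes d r :: real
  assumes "0 \<le> d" "0 \<le> r" "0 < k"
  shows "d * (r / real k) ^ k \<le> ((d + r) / real (Suc k)) ^ Suc k"
proof -
  define z where "z = r / real k"
  define g where "g = (d + r) / real (Suc k)"
  have z: "z \<ge> 0" and g: "g \<ge> 0" using assms by (auto simp: z_def g_def)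
  have d: "d = real (Suc k) * g - real k * z" using assms by (simp add: z_def g_def)
  have "d * z ^ k \<le> g ^ Suc k"
  proof (cases "z = 0")
    case True
    then show ?thesis using assms g by (simp add: zero_power)
  next
    case False
    with z have z': "z > 0" by simp
    \<comment> \<open>Bernoulli at the ratio \<open>g / z\<close>; after multiplication by
      \<open>z ^ Suc k\<close> its left side is exactly \<open>d * z ^ k\<close>.\<close>
    have "1 + real (Suc k) * (g / z - 1) \<le> (1 + (g / z - 1)) ^ Suc k"
      using g z' by (intro Bernoulli_inequality) simp
    then have "(1 + real (Suc k) * (g / z - 1)) * z ^ Suc k \<le> (g / z) ^ Suc k * z ^ Suc k"
      using z' by (intro mult_right_mono) auto
    also have "(g / z) ^ Suc k * z ^ Suc k = g ^ Suc k"
      using z' by (simp add: power_divide)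
    also have "(1 + real (Suc k) * (g / z - 1)) * z ^ Suc k = d * z ^ k"
      unfolding d using z' by (simp add: field_simps)
    finally show ?thesis .
  qed
  then show ?thesis by (simp add: z_def g_def)
qed

text \<open>A product of \<open>k + 1\<close> factors is compared with a mean taken over
  \<open>k + 2\<close>, so AM-GM alone is one factor short. If \<open>z\<close> is at most the mean
  \<open>g\<close>, every factor is at most \<open>g\<close>; otherwise AM-GM for
  \<open>d * z ^ Suc k\<close> is divided by one factor \<open>z > g\<close>.\<close>

lemma min_step_power_le:
  fixes d r :: real
  assumes "0 \<le> d" "0 \<le> r"
  shows "min d (r / real (Suc k)) * (r / real (Suc k)) ^ k \<le> ((d + r) / real (Suc (Suc k))) ^ Suc k"
proof -
  define z where "z = r / real (Suc k)"
  define g where "g = (d + r) / real (Suc (Suc k))"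
  have z: "z \<ge> 0" and g: "g \<ge> 0" using assms by (auto simp: z_def g_def)
  have d: "d = real (Suc (Suc k)) * g - real (Suc k) * z" using assms by (simp add: z_def g_def)
  have "min d z * z ^ k \<le> g ^ Suc k"
  proof (cases "z \<le> g")
    case True
    have "min d z * z ^ k \<le> z * z ^ k" using z by (intro mult_right_mono) auto
    also have "\<dots> \<le> g ^ Suc k" using True z power_mono[of z g "Suc k"] by simp
    finally show ?thesis .
  next
    case False
    then have z': "z > 0" and gz: "g < z" using g by auto
    have "d * z ^ Suc k \<le> g ^ Suc (Suc k)"
      using power_mean_step[OF assms, of "Suc k"] by (simp add: z_def g_def)
    also have "\<dots> \<le> g ^ Suc k * z" using gz g mult_left_mono[of g z "g ^ Suc k"] by (simp add: mult_ac)
    finally have "(d * z ^ k) * z \<le> g ^ Suc k * z" by (simp add: mult_ac)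
    then have "d * z ^ k \<le> g ^ Suc k" using z' by simp
    moreover have "min d z * z ^ k \<le> d * z ^ k" using z by (intro mult_right_mono) auto
    ultimately show ?thesis by linarith
  qed
  then show ?thesis by (simp add: z_def g_def)
qed

text \<open>Measures are total functions on an arbitrary type, so compactness comes from Tychonoff;
  fixing the coordinates outside \<open>E\<close> to 0 makes every factor of the product
  compact.\<close>

lemma compact_simplex:
  assumes "finite E"
  shows "compact {\<mu> :: 'a \<Rightarrow> real. (\<forall>e\<in>E. 0 \<le> \<mu> e) \<and> (\<forall>e. e \<notin> E \<longrightarrow> \<mu> e = 0) \<and> sum \<mu> E = 1}"
proof -
  let ?B = "PiE UNIV (\<lambda>e. if e \<in> E then {0..1} else {0::real})"
  have "compactin (product_topology (\<lambda>_::'a. euclidean) UNIV) ?B"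
    by (auto simp: compactin_PiE)
  then have "compact ?B" by (simp add: euclidean_product_topology)
  moreover have "closed {\<mu> :: 'a \<Rightarrow> real. sum \<mu> E = 1}"
    by (intro closed_Collect_eq continuous_intros continuous_on_product_coordinates)
  ultimately have "compact (?B \<inter> {\<mu>. sum \<mu> E = 1})" by (rule compact_Int_closed)
  moreover have "?B \<inter> {\<mu>. sum \<mu> E = 1}
      = {\<mu>. (\<forall>e\<in>E. 0 \<le> \<mu> e) \<and> (\<forall>e. e \<notin> E \<longrightarrow> \<mu> e = 0) \<and> sum \<mu> E = 1}"
    using member_le_sum[OF _ _ assms] by (fastforce simp: PiE_iff split: if_splits)
  ultimately show ?thesis by simp
qed

text \<open>Lagrange's condition on the simplex: by Euler's identity for a form of degree
  \<open>m\<close> the multiplier is \<open>m * F \<mu>\<close>. It is claimed only where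
  \<open>\<mu> e > 0\<close>, since there the weight can be moved in both directions.\<close>

lemma prod_sum_maximizer:
  fixes c :: "'a set \<Rightarrow> real" and m :: nat
  assumes F_def: "F = (\<lambda>\<mu>. \<Sum>X\<in>\<X>. c X * prod \<mu> X)"
    and E: "finite E" "E \<noteq> {}" and X: "finite \<X>" "\<And>X. X \<in> \<X> \<Longrightarrow> X \<subseteq> E \<and> card X = m"
  obtains \<mu> where "\<And>e. 0 \<le> \<mu> e" "\<And>e. e \<notin> E \<Longrightarrow> \<mu> e = 0" "sum \<mu> E = 1"
    "\<And>\<nu>. (\<And>e. e \<in> E \<Longrightarrow> 0 \<le> \<nu> e) \<Longrightarrow> sum \<nu> E = 1 \<Longrightarrow> F \<nu> \<le> F \<mu>"
    "\<And>e. e \<in> E \<Longrightarrow> 0 < \<mu> e \<Longrightarrow> real m * F \<mu> = (\<Sum>X\<in>{X\<in>\<X>. e \<in> X}. c X * prod \<mu> (X - {e}))"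
proof -
  let ?P = "{\<mu> :: 'a \<Rightarrow> real. (\<forall>e\<in>E. 0 \<le> \<mu> e) \<and> (\<forall>e. e \<notin> E \<longrightarrow> \<mu> e = 0) \<and> sum \<mu> E = 1}"
  have "compact ?P" by (rule compact_simplex[OF E(1)])
  moreover have "?P \<noteq> {}"
  proof -
    obtain a where "a \<in> E" using E by auto
    then have "(\<lambda>e. if e = a then 1 else 0) \<in> ?P" using E by auto
    then show ?thesis by (metis empty_iff)
  qed
  moreover have "continuous_on ?P F"
  proof -
    have "continuous_on ?P (\<lambda>\<mu>. \<mu> e)" for e
      by (rule continuous_on_subset[OF continuous_on_product_coordinates]) simp
    then show ?thesis
      unfolding F_def by (intro continuous_on_sum continuous_on_mult_left continuous_on_prod)
  qed
  ultimately obtain \<mu> where \<mu>: "\<mu> \<in> ?P" and max: "\<And>\<nu>. \<nu> \<in> ?P \<Longrightarrow> F \<nu> \<le> F \<mu>"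
    using continuous_attains_sup[of ?P F] by auto
  have Fcong: "F \<nu> = F \<nu>'" if "\<And>e. e \<in> E \<Longrightarrow> \<nu> e = \<nu>' e" for \<nu> \<nu>'
  proof -
    have "prod \<nu> X = prod \<nu>' X" if "X \<in> \<X>" for X
      using X(2)[OF \<open>X \<in> \<X>\<close>] \<open>\<And>e. e \<in> E \<Longrightarrow> \<nu> e = \<nu>' e\<close> by (intro prod.cong) auto
    then show ?thesis unfolding F_def by simp
  qed
  have max': "F \<nu> \<le> F \<mu>" if nn: "\<And>e. e \<in> E \<Longrightarrow> 0 \<le> \<nu> e" and s: "sum \<nu> E = 1" for \<nu>
  proof -
    let ?n = "\<lambda>e. if e \<in> E then \<nu> e else 0"
    have "sum ?n E = 1" using s by simp
    then have "?n \<in> ?P" using nn by auto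
    then have "F ?n \<le> F \<mu>" by (rule max)
    then show ?thesis using Fcong[of ?n \<nu>] by auto
  qed
  have grad: "real m * F \<mu> = (\<Sum>X\<in>{X\<in>\<X>. e \<in> X}. c X * prod \<mu> (X - {e}))" (is "_ = ?G")
    if e: "e \<in> E" "0 < \<mu> e" for e
  proof -
    have lin: "F (\<mu>(e := \<mu> e + s)) = F \<mu> + s * ?G" for s
    proof -
      have "c X * prod (\<mu>(e := \<mu> e + s)) X
          = c X * prod \<mu> X + s * (if e \<in> X then c X * prod \<mu> (X - {e}) else 0)" if "X \<in> \<X>" for X
      proof (cases "e \<in> X")
        case True
        have "finite X" using X(2)[OF that] E(1) finite_subset by blast
        then show ?thesis using True by (simp add: prod.remove[of X e] algebra_simps)
      next
        case False
        then have "prod (\<mu>(e := \<mu> e + s)) X = prod \<mu> X" by (intro prod.cong) auto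
        then show ?thesis using False by simp
      qed
      then have "F (\<mu>(e := \<mu> e + s))
          = F \<mu> + s * (\<Sum>X\<in>\<X>. if e \<in> X then c X * prod \<mu> (X - {e}) else 0)"
        unfolding F_def by (simp add: sum.distrib sum_distrib_left)
      then show ?thesis using X(1) by (simp add: sum.inter_filter)
    qed
    have le1: "\<mu> e \<le> 1" using member_le_sum[of e E \<mu>] e \<mu> E by auto
    have hom: "F \<mu> + s * ?G \<le> F \<mu> * (1 + s) ^ m" if s: "\<bar>0 - s\<bar> < \<mu> e" for s
    proof -
      txt \<open>By homogeneity it is enough to rescale the perturbed weights to total mass 1.\<close>
      let ?n = "\<lambda>f. (\<mu>(e := \<mu> e + s)) f / (1 + s)"
      have pos: "1 + s > 0" using s le1 by linarith
      have "sum (\<mu>(e := \<mu> e + s)) E = 1 + s"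
        using e \<mu> E by (simp add: sum.remove[of E e])
      then have "sum ?n E = 1" using pos by (simp flip: sum_divide_distrib)
      moreover have "0 \<le> ?n f" if "f \<in> E" for f using pos s \<mu> that by auto
      ultimately have "F ?n \<le> F \<mu>" by (intro max') auto
      moreover have "F ?n = F (\<mu>(e := \<mu> e + s)) / (1 + s) ^ m"
        unfolding F_def sum_divide_distrib
        by (intro sum.cong refl) (use X in \<open>simp add: prod_dividef\<close>)
      ultimately have "F (\<mu>(e := \<mu> e + s)) / (1 + s) ^ m \<le> F \<mu>" by simp
      then show ?thesis using pos by (simp only: lin) (simp add: pos_divide_le_eq)
    qed
    define h where "h = (\<lambda>s. F \<mu> * (1 + s) ^ m - (F \<mu> + s * ?G))"
    have "DERIV h 0 :> F \<mu> * real m - ?G"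
      unfolding h_def by (auto intro!: derivative_eq_intros)
    moreover have "\<forall>s. \<bar>0 - s\<bar> < \<mu> e \<longrightarrow> h 0 \<le> h s"
      using hom by (auto simp: h_def)
    ultimately have "F \<mu> * real m - ?G = 0" using DERIV_local_min[of h _ 0 "\<mu> e"] e(2) by blast
    then show ?thesis by (simp add: mult.commute)
  qed
  have "0 \<le> \<mu> e" for e using \<mu> by (cases "e \<in> E") auto
  then show ?thesis by (rule that[of \<mu>]) (use \<mu> max' grad in auto)
qed

section \<open>Paths and cycles as vertex lists\<close>

fun path_edges :: "'a list \<Rightarrow> 'a set set" where
  "path_edges (a # b # l) = insert {a, b} (path_edges (b # l))"
| "path_edges _ = {}"

text \<open>The product is taken along the list and not over the edge set, so that removing the head
  vertex is a computation rule. On lists without repetition both products agree.\<close>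

fun path_weight :: "('a set \<Rightarrow> real) \<Rightarrow> 'a list \<Rightarrow> real" where
  "path_weight \<mu> (a # b # l) = \<mu> {a, b} * path_weight \<mu> (b # l)"
| "path_weight \<mu> _ = 1"

lemma path_edges_subset: "e \<in> path_edges l \<Longrightarrow> e \<subseteq> set l"
  by (induction l rule: path_edges.induct) auto

lemma finite_path_edges: "finite (path_edges l)"
  by (induction l rule: path_edges.induct) auto

lemma not_mem_path_edges: "a \<notin> set l \<Longrightarrow> {a, b} \<notin> path_edges l"
  using path_edges_subset by fastforce

lemma prod_path_edges: "distinct l \<Longrightarrow> prod \<mu> (path_edges l) = path_weight \<mu> l"
  by (induction l rule: path_edges.induct) (auto simp: finite_path_edges not_mem_path_edges)

lemma card_path_edges: "distinct l \<Longrightarrow> card (path_edges l) = length l - 1"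
  by (induction l rule: path_edges.induct) (auto simp: finite_path_edges not_mem_path_edges)

lemma path_edges_append:
  "p \<noteq> [] \<Longrightarrow> q \<noteq> [] \<Longrightarrow> path_edges (p @ q) = insert {last p, hd q} (path_edges p \<union> path_edges q)"
proof (induction p rule: path_edges.induct)
  case ("2_2" v)
  then show ?case by (cases q) auto
qed auto

lemma path_weight_append:
  "p \<noteq> [] \<Longrightarrow> q \<noteq> [] \<Longrightarrow> path_weight \<mu> (p @ q) = path_weight \<mu> p * \<mu> {last p, hd q} * path_weight \<mu> q"
proof (induction p rule: path_edges.induct)
  case ("2_2" v)
  then show ?case by (cases q) auto
qed auto

lemma path_edges_rev: "path_edges (rev l) = path_edges l"
proof (induction l rule: path_edges.induct)
  case (1 a b l)
  then show ?case using path_edges_append[of "rev l @ [b]" "[a]"] by (simp add: insert_commute)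
qed auto

lemma path_weight_rev: "path_weight \<mu> (rev l) = path_weight \<mu> l"
proof (induction l rule: path_edges.induct)
  case (1 a b l)
  then show ?case using path_weight_append[of "rev l @ [b]" "[a]" \<mu>] by (simp add: insert_commute)
qed auto

lemma path_edges_split:
  "e \<in> path_edges l \<Longrightarrow> \<exists>p q. l = p @ q \<and> p \<noteq> [] \<and> q \<noteq> [] \<and> e = {last p, hd q}"
proof (induction l rule: path_edges.induct)
  case (1 a b l)
  show ?case
  proof (cases "e = {a, b}")
    case True
    then show ?thesis by (intro exI[of _ "[a]"] exI[of _ "b # l"]) auto
  next
    case False
    with 1 obtain p q where "b # l = p @ q" "p \<noteq> []" "q \<noteq> []" "e = {last p, hd q}" by auto
    then show ?thesis by (intro exI[of _ "a # p"] exI[of _ q]) auto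
  qed
qed auto

lemma path_weight_nonneg: "(\<And>e. 0 \<le> \<mu> e) \<Longrightarrow> 0 \<le> path_weight \<mu> l"
  by (induction l rule: path_edges.induct) auto

lemma path_edges_nth: "{{vs ! i, vs ! (i + 1)} | i. i + 1 < length vs} = path_edges vs"
proof (induction vs rule: path_edges.induct)
  case (1 a b l)
  have "{{(a # b # l) ! i, (a # b # l) ! (i + 1)} | i. i + 1 < length (a # b # l)}
      = insert {a, b} {{(b # l) ! i, (b # l) ! (i + 1)} | i. i + 1 < length (b # l)}" (is "?L = ?R")
  proof
    show "?L \<subseteq> ?R"
    proof
      fix e assume "e \<in> ?L"
      then obtain i where i: "i + 1 < length (a # b # l)" "e = {(a # b # l) ! i, (a # b # l) ! (i + 1)}"
        by blast
      then show "e \<in> ?R" by (cases i) auto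
    qed
    show "?R \<subseteq> ?L"
    proof
      fix e assume "e \<in> ?R"
      then consider "e = {a, b}"
        | i where "i + 1 < length (b # l)" "e = {(b # l) ! i, (b # l) ! (i + 1)}" by blast
      then show "e \<in> ?L"
      proof cases
        case 1
        then show ?thesis by (auto intro!: exI[of _ 0])
      next
        case (2 i)
        then show ?thesis by (auto intro!: exI[of _ "Suc i"])
      qed
    qed
  qed
  then show ?case using 1 by simp
qed auto

definition cycle_edges :: "'a list \<Rightarrow> 'a set set" where
  "cycle_edges l = insert {last l, hd l} (path_edges l)"

lemma cycle_edges_nth:
  assumes "vs \<noteq> []"
  shows "{{vs ! i, vs ! ((i + 1) mod length vs)} | i. i < length vs} = cycle_edges vs"
proof -
  let ?m = "length vs"
  have "{{vs ! i, vs ! ((i + 1) mod ?m)} | i. i < ?m}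
      = (\<lambda>i. {vs ! i, vs ! ((i + 1) mod ?m)}) ` insert (?m - 1) {i. i + 1 < ?m}"
  proof -
    have "{i. i < ?m} = insert (?m - 1) {i. i + 1 < ?m}" using assms by (auto simp: less_diff_conv)
    moreover have "{{vs ! i, vs ! ((i + 1) mod ?m)} | i. i < ?m}
        = (\<lambda>i. {vs ! i, vs ! ((i + 1) mod ?m)}) ` {i. i < ?m}" by blast
    ultimately show ?thesis by simp
  qed
  also have "\<dots> = insert {last vs, hd vs} ((\<lambda>i. {vs ! i, vs ! (i + 1)}) ` {i. i + 1 < ?m})"
    using assms by (simp add: last_conv_nth hd_conv_nth)
  also have "\<dots> = cycle_edges vs"
    unfolding cycle_edges_def by (subst path_edges_nth[symmetric]) (auto simp: image_def)
  finally show ?thesis .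
qed

lemma cycle_edges_swap:
  "p \<noteq> [] \<Longrightarrow> q \<noteq> [] \<Longrightarrow> cycle_edges (p @ q) = cycle_edges (q @ p)"
  by (auto simp: cycle_edges_def path_edges_append)

lemma cycle_edges_rev: "cycle_edges (rev l) = cycle_edges l"
  by (cases "l = []") (auto simp: cycle_edges_def path_edges_rev hd_rev last_rev insert_commute)

text \<open>On two vertices the closing edge would repeat the path edge; from three vertices on it
  is new, which gives a cycle as many edges as vertices.\<close>

lemma last_hd_not_mem_path_edges:
  assumes "distinct l" "3 \<le> length l"
  shows "{last l, hd l} \<notin> path_edges l"
proof
  obtain a l' where l: "l = a # l'" using assms by (cases l) auto
  obtain b l'' where l': "l' = b # l''" using assms l by (cases l') auto
  have l'': "l'' \<noteq> []" using assms l l' by auto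
  assume "{last l, hd l} \<in> path_edges l"
  moreover have "{a, last l''} \<notin> path_edges (b # l'')"
    using assms l l' by (intro not_mem_path_edges) auto
  ultimately have "{last l'', a} = {a, b}"
    using l l' l'' by (simp add: insert_commute)
  then have "last l'' = b" using assms l l' by (auto simp: doubleton_eq_iff)
  then show False using l'' assms l l' by auto
qed

lemma card_cycle_edges: "distinct l \<Longrightarrow> 3 \<le> length l \<Longrightarrow> card (cycle_edges l) = length l"
  by (simp add: cycle_edges_def finite_path_edges last_hd_not_mem_path_edges card_path_edges)

section \<open>Sums over injective vertex lists: linking paths and forks\<close>

definition distinct_lists :: "nat \<Rightarrow> 'a set \<Rightarrow> 'a list set" where
  "distinct_lists k V = {l. length l = k \<and> distinct l \<and> set l \<subseteq> V}"

lemma finite_distinct_lists: "finite V \<Longrightarrow> finite (distinct_lists k V)"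
  by (rule finite_subset[OF _ finite_lists_length_eq[of V k]]) (auto simp: distinct_lists_def)

lemma distinct_lists_0 [simp]: "distinct_lists 0 V = {[]}"
  by (auto simp: distinct_lists_def)

lemma sum_distinct_lists_Suc:
  assumes "finite V"
  shows "(\<Sum>l\<in>distinct_lists (Suc k) V. f l) = (\<Sum>v\<in>V. \<Sum>l\<in>distinct_lists k (V - {v}). f (v # l))"
proof -
  have eq: "distinct_lists (Suc k) V = (\<Union>v\<in>V. (#) v ` distinct_lists k (V - {v}))"
  proof
    show "distinct_lists (Suc k) V \<subseteq> (\<Union>v\<in>V. (#) v ` distinct_lists k (V - {v}))"
    proof
      fix l assume l: "l \<in> distinct_lists (Suc k) V"
      then obtain v l' where "l = v # l'" by (auto simp: distinct_lists_def length_Suc_conv)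
      with l have "v \<in> V" "l' \<in> distinct_lists k (V - {v})" by (auto simp: distinct_lists_def)
      then show "l \<in> (\<Union>v\<in>V. (#) v ` distinct_lists k (V - {v}))" using \<open>l = v # l'\<close> by blast
    qed
  qed (auto simp: distinct_lists_def)
  have "(\<Sum>l\<in>distinct_lists (Suc k) V. f l) = (\<Sum>v\<in>V. \<Sum>l\<in>(#) v ` distinct_lists k (V - {v}). f l)"
    unfolding eq using assms by (intro sum.UNION_disjoint) (auto simp: finite_distinct_lists)
  also have "\<dots> = (\<Sum>v\<in>V. \<Sum>l\<in>distinct_lists k (V - {v}). f (v # l))"
    by (simp add: sum.reindex)
  finally show ?thesis .
qed

text \<open>In \<open>link_sum\<close> the number \<open>k\<close> counts the interior vertices of the path; in \<open>fork_sum\<close> the numbers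
  \<open>i\<close> and \<open>j\<close> count the vertices that follow \<open>x\<close> and \<open>y\<close> on two disjoint paths.\<close>

definition link_sum :: "('a set \<Rightarrow> real) \<Rightarrow> nat \<Rightarrow> 'a set \<Rightarrow> 'a \<Rightarrow> 'a \<Rightarrow> real" where
  "link_sum \<mu> k V x y = (\<Sum>l\<in>distinct_lists k V. path_weight \<mu> (x # l @ [y]))"

definition fork_sum :: "('a set \<Rightarrow> real) \<Rightarrow> nat \<Rightarrow> nat \<Rightarrow> 'a set \<Rightarrow> 'a \<Rightarrow> 'a \<Rightarrow> real" where
  "fork_sum \<mu> i j V x y =
     (\<Sum>l\<in>distinct_lists (i + j) V. path_weight \<mu> (x # take i l) * path_weight \<mu> (y # drop i l))"

lemma link_sum_0: "link_sum \<mu> 0 V x y = \<mu> {x, y}"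
  by (simp add: link_sum_def)

lemma link_sum_Suc:
  "finite V \<Longrightarrow> link_sum \<mu> (Suc k) V x y = (\<Sum>v\<in>V. \<mu> {x, v} * link_sum \<mu> k (V - {v}) v y)"
  by (simp add: link_sum_def sum_distinct_lists_Suc sum_distrib_left)

lemma fork_sum_0_0: "fork_sum \<mu> 0 0 V x y = 1"
  by (simp add: fork_sum_def)

lemma fork_sum_Suc:
  "finite V \<Longrightarrow> fork_sum \<mu> (Suc i) j V x y = (\<Sum>v\<in>V. \<mu> {x, v} * fork_sum \<mu> i j (V - {v}) v y)"
  by (simp add: fork_sum_def sum_distinct_lists_Suc sum_distrib_left mult.assoc)

lemma link_sum_commute: "link_sum \<mu> k V x y = link_sum \<mu> k V y x"
  unfolding link_sum_def
proof (rule sum.reindex_bij_witness[of _ rev rev], goal_cases)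
  case (5 l)
  show ?case using path_weight_rev[of \<mu> "x # l @ [y]"] by simp
qed (auto simp: distinct_lists_def)

text \<open>The two blocks of the list are exchanged. Together with the recursion at
  \<open>x\<close> this also allows a vertex to be revealed on the side of \<open>y\<close>.\<close>

lemma fork_sum_commute: "fork_sum \<mu> i j V x y = fork_sum \<mu> j i V y x"
  unfolding fork_sum_def
proof (rule sum.reindex_bij_witness[of _ "\<lambda>l. drop j l @ take j l" "\<lambda>l. drop i l @ take i l"], goal_cases)
  case (2 l)
  then have "distinct (take i l @ drop i l)" "set (take i l @ drop i l) \<subseteq> V"
    by (simp_all add: distinct_lists_def)
  with 2 show ?case unfolding distinct_append set_append by (auto simp: distinct_lists_def)
next
  case (4 l)
  then have "distinct (take j l @ drop j l)" "set (take j l @ drop j l) \<subseteq> V"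
    by (simp_all add: distinct_lists_def)
  with 4 show ?case unfolding distinct_append set_append by (auto simp: distinct_lists_def)
qed (auto simp: distinct_lists_def)

lemma link_sum_nonneg: "(\<And>e. 0 \<le> \<mu> e) \<Longrightarrow> 0 \<le> link_sum \<mu> k V x y"
  by (auto simp: link_sum_def intro!: sum_nonneg path_weight_nonneg)

lemma fork_sum_nonneg: "(\<And>e. 0 \<le> \<mu> e) \<Longrightarrow> 0 \<le> fork_sum \<mu> i j V x y"
  by (auto simp: fork_sum_def intro!: sum_nonneg mult_nonneg_nonneg path_weight_nonneg)

section \<open>Bounds for walks, links and forks by the available edge mass\<close>

definition edge_mass :: "('a set \<Rightarrow> real) \<Rightarrow> 'a set \<Rightarrow> real" where
  "edge_mass \<mu> U = (\<Sum>e | e \<subseteq> U \<and> card e = 2. \<mu> e)"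

lemma edge_mass_nonneg: "(\<And>e. 0 \<le> \<mu> e) \<Longrightarrow> 0 \<le> edge_mass \<mu> U"
  by (auto simp: edge_mass_def intro: sum_nonneg)

lemma edge_mass_insert:
  assumes "finite U" "u \<notin> U"
  shows "edge_mass \<mu> (insert u U) = (\<Sum>v\<in>U. \<mu> {u, v}) + edge_mass \<mu> U"
proof -
  have eq: "{e. e \<subseteq> insert u U \<and> card e = 2} = (\<lambda>v. {u, v}) ` U \<union> {e. e \<subseteq> U \<and> card e = 2}"
  proof -
    have "e \<in> (\<lambda>v. {u, v}) ` U" if "e \<subseteq> insert u U" "card e = 2" "\<not> e \<subseteq> U" for e
      using that by (auto simp: card_2_iff)
    then show ?thesis using assms by (auto simp: card_2_iff)
  qed
  have "sum \<mu> ((\<lambda>v. {u, v}) ` U) = (\<Sum>v\<in>U. \<mu> {u, v})"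
    by (subst sum.reindex) (auto simp: inj_on_def doubleton_eq_iff)
  moreover have "(\<lambda>v. {u, v}) ` U \<inter> {e. e \<subseteq> U \<and> card e = 2} = {}" using assms by auto
  ultimately show ?thesis
    unfolding edge_mass_def eq using assms by (subst sum.union_disjoint) auto
qed

text \<open>The walk never returns to \<open>w\<close>, so edges at \<open>w\<close> serve only the
  first step. The mass splits into the part at \<open>w\<close> and the part inside
  \<open>V\<close>, which pays for the remaining steps by induction; AM-GM recombines the
  two.\<close>

lemma walk_sum_le:
  assumes "finite V" "w \<notin> V" "\<And>e. 0 \<le> \<mu> e" "0 < k"
  shows "(\<Sum>l\<in>distinct_lists k V. path_weight \<mu> (w # l)) \<le> (edge_mass \<mu> (insert w V) / real k) ^ k"
  using assms(1,2,4)
proof (induction k arbitrary: V w)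
  case (Suc k)
  have step: "(\<Sum>l\<in>distinct_lists (Suc k) V. path_weight \<mu> (w # l))
      = (\<Sum>v\<in>V. \<mu> {w, v} * (\<Sum>l\<in>distinct_lists k (V - {v}). path_weight \<mu> (v # l)))"
    using Suc.prems by (simp add: sum_distinct_lists_Suc sum_distrib_left)
  have mass: "edge_mass \<mu> (insert w V) = (\<Sum>v\<in>V. \<mu> {w, v}) + edge_mass \<mu> V"
    using Suc.prems by (simp add: edge_mass_insert)
  show ?case
  proof (cases "k = 0")
    case True
    then show ?thesis unfolding step mass using edge_mass_nonneg[of \<mu> V] assms(3) by simp
  next
    case False
    have "(\<Sum>l\<in>distinct_lists (Suc k) V. path_weight \<mu> (w # l))
        \<le> (\<Sum>v\<in>V. \<mu> {w, v} * (edge_mass \<mu> V / real k) ^ k)"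
      unfolding step
    proof (intro sum_mono mult_left_mono assms(3))
      fix v assume v: "v \<in> V"
      then show "(\<Sum>l\<in>distinct_lists k (V - {v}). path_weight \<mu> (v # l)) \<le> (edge_mass \<mu> V / real k) ^ k"
        using Suc.IH[of "V - {v}" v] Suc.prems False by (simp add: insert_absorb)
    qed
    also have "\<dots> \<le> (edge_mass \<mu> (insert w V) / real (Suc k)) ^ Suc k"
      unfolding mass sum_distrib_right[symmetric] using False assms(3)
      by (intro power_mean_step sum_nonneg edge_mass_nonneg) auto
    finally show ?thesis .
  qed
qed simp

text \<open>The path has \<open>k + 1\<close> edges. One of them is paid by \<open>t\<close>, yet
  the mass is still divided by \<open>k + 1\<close> although only \<open>k\<close> factors remain;
  this stronger denominator makes the bound an equality for the uniform measure on a cycle, once the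
  edge between \<open>x\<close> and \<open>y\<close> is given weight 0.\<close>

lemma link_sum_le_max:
  assumes "finite V" "x \<notin> V" "y \<notin> V" "x \<noteq> y" "\<And>e. 0 \<le> \<mu> e" "\<And>e. \<mu> e \<le> t"
  shows "link_sum \<mu> k V x y \<le> t * (edge_mass \<mu> (insert x (insert y V)) / real (Suc k)) ^ k"
  using assms(1-4)
proof (induction k arbitrary: V x)
  case 0
  then show ?case using assms(6) by (simp add: link_sum_0)
next
  case (Suc k)
  let ?d = "\<Sum>v\<in>V. \<mu> {x, v}" and ?r = "edge_mass \<mu> (insert y V)"
  have t: "0 \<le> t" using assms(5,6) order_trans by blast
  have d: "0 \<le> ?d" and r: "0 \<le> ?r" by (auto intro!: sum_nonneg edge_mass_nonneg assms(5))
  have mass: "edge_mass \<mu> (insert x (insert y V)) = \<mu> {x, y} + ?d + ?r"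
    using Suc.prems by (simp add: edge_mass_insert[of "insert y V" x])
  txt \<open>The edge at \<open>x\<close> can be summed exactly (\<open>le1\<close>), or bounded by \<open>t\<close>, which leaves a free walk
    from \<open>y\<close> (\<open>le2\<close>). The first bound is good for small \<open>?d\<close>, the second for large \<open>?d\<close>.\<close>
  have "link_sum \<mu> (Suc k) V x y = (\<Sum>v\<in>V. \<mu> {x, v} * link_sum \<mu> k (V - {v}) v y)"
    using Suc.prems by (simp add: link_sum_Suc)
  also have "\<dots> \<le> (\<Sum>v\<in>V. \<mu> {x, v} * (t * (?r / real (Suc k)) ^ k))"
  proof (intro sum_mono mult_left_mono assms(5))
    fix v assume v: "v \<in> V"
    then have "insert v (insert y (V - {v})) = insert y V" by auto
    then show "link_sum \<mu> k (V - {v}) v y \<le> t * (?r / real (Suc k)) ^ k"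
      using Suc.IH[of "V - {v}" v] Suc.prems v by auto
  qed
  finally have le1: "link_sum \<mu> (Suc k) V x y \<le> t * (?d * (?r / real (Suc k)) ^ k)"
    unfolding sum_distrib_right[symmetric] by (simp add: mult_ac)
  have "link_sum \<mu> (Suc k) V x y = (\<Sum>l\<in>distinct_lists (Suc k) V. path_weight \<mu> (x # l @ [y]))"
    by (simp add: link_sum_def)
  also have "\<dots> \<le> (\<Sum>l\<in>distinct_lists (Suc k) V. t * path_weight \<mu> (l @ [y]))"
  proof (rule sum_mono)
    fix l assume "l \<in> distinct_lists (Suc k) V"
    then obtain v l' where "l = v # l'" by (auto simp: distinct_lists_def length_Suc_conv)
    then show "path_weight \<mu> (x # l @ [y]) \<le> t * path_weight \<mu> (l @ [y])"
      using assms(5,6) by (simp add: mult_right_mono path_weight_nonneg)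
  qed
  also have "\<dots> = t * (\<Sum>l\<in>distinct_lists (Suc k) V. path_weight \<mu> (l @ [y]))"
    by (simp add: sum_distrib_left)
  also have "(\<Sum>l\<in>distinct_lists (Suc k) V. path_weight \<mu> (l @ [y]))
      = (\<Sum>l\<in>distinct_lists (Suc k) V. path_weight \<mu> (y # l))"
  proof (rule sum.reindex_bij_witness[of _ rev rev], goal_cases)
    case (5 l)
    show ?case using path_weight_rev[of \<mu> "l @ [y]"] by simp
  qed (auto simp: distinct_lists_def)
  also have "t * \<dots> \<le> t * (?r / real (Suc k)) ^ Suc k"
    using walk_sum_le[of V y \<mu> "Suc k"] Suc.prems assms(5) t by (intro mult_left_mono) auto
  finally have le2: "link_sum \<mu> (Suc k) V x y \<le> t * (?r / real (Suc k) * (?r / real (Suc k)) ^ k)"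
    by simp
  have "link_sum \<mu> (Suc k) V x y \<le> t * (min ?d (?r / real (Suc k)) * (?r / real (Suc k)) ^ k)"
    using le1 le2 by (simp add: min_def)
  also have "\<dots> \<le> t * ((?d + ?r) / real (Suc (Suc k))) ^ Suc k"
    by (intro mult_left_mono min_step_power_le d r t)
  also have "\<dots> \<le> t * ((\<mu> {x, y} + ?d + ?r) / real (Suc (Suc k))) ^ Suc k"
    using t d r assms(5)[of "{x, y}"] by (intro mult_left_mono power_mono divide_right_mono) auto
  finally show ?case unfolding mass .
qed

text \<open>If \<open>i > 0\<close>, all three families have a next vertex \<open>v\<close> after
  \<open>x\<close>; revealing it gives the common factor \<open>\<mu> {x, v}\<close> and the same
  triple with \<open>i\<close> lowered by one, so a single AM-GM step serves all three. For
  \<open>i = j = 0\<close> the terms are the weight of the edge between \<open>x\<close> and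
  \<open>y\<close> and the masses from \<open>x\<close> and from \<open>y\<close> into
  \<open>V\<close>, which belong to disjoint sets of edges.\<close>

lemma link_fork_sum_le:
  assumes "finite V" "x \<notin> V" "y \<notin> V" "x \<noteq> y" "\<And>e. 0 \<le> \<mu> e"
  shows "link_sum \<mu> (i + j) V x y + fork_sum \<mu> (Suc i) j V x y + fork_sum \<mu> i (Suc j) V x y
     \<le> (edge_mass \<mu> (insert x (insert y V)) / real (Suc (i + j))) ^ Suc (i + j)"
  using assms(1-4)
proof (induction "i + j" arbitrary: i j V x y)
  case 0
  have "edge_mass \<mu> (insert x (insert y V))
      = \<mu> {x, y} + (\<Sum>v\<in>V. \<mu> {x, v}) + (\<Sum>v\<in>V. \<mu> {y, v}) + edge_mass \<mu> V"
    using 0 by (simp add: edge_mass_insert[of "insert y V" x] edge_mass_insert[of V y])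
  moreover have "fork_sum \<mu> 0 (Suc 0) V x y = (\<Sum>v\<in>V. \<mu> {y, v})"
    using 0 by (simp add: fork_sum_commute[of \<mu> 0] fork_sum_Suc fork_sum_0_0)
  ultimately show ?case using 0 edge_mass_nonneg[of \<mu> V] assms(5)
    by (simp add: link_sum_0 fork_sum_Suc fork_sum_0_0)
next
  case (Suc k)
  have step: "link_sum \<mu> (Suc (a + b)) V x y + fork_sum \<mu> (Suc (Suc a)) b V x y + fork_sum \<mu> (Suc a) (Suc b) V x y
      \<le> (edge_mass \<mu> (insert x (insert y V)) / real (Suc (Suc (a + b)))) ^ Suc (Suc (a + b))"
    if k: "k = a + b" and V: "finite V" "x \<notin> V" "y \<notin> V" "x \<noteq> y" for a b V x y
  proof -
    let ?d = "\<Sum>v\<in>V. \<mu> {x, v}" and ?r = "edge_mass \<mu> (insert y V)"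
    have d: "0 \<le> ?d" and r: "0 \<le> ?r" by (auto intro!: sum_nonneg edge_mass_nonneg assms(5))
    have mass: "edge_mass \<mu> (insert x (insert y V)) = \<mu> {x, y} + ?d + ?r"
      using V by (simp add: edge_mass_insert[of "insert y V" x])
    have "link_sum \<mu> (Suc (a + b)) V x y + fork_sum \<mu> (Suc (Suc a)) b V x y + fork_sum \<mu> (Suc a) (Suc b) V x y
       = (\<Sum>v\<in>V. \<mu> {x, v} * (link_sum \<mu> (a + b) (V - {v}) v y
            + fork_sum \<mu> (Suc a) b (V - {v}) v y + fork_sum \<mu> a (Suc b) (V - {v}) v y))"
      using V by (simp add: link_sum_Suc fork_sum_Suc sum.distrib distrib_left)
    also have "\<dots> \<le> (\<Sum>v\<in>V. \<mu> {x, v} * (?r / real (Suc (a + b))) ^ Suc (a + b))"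
    proof (intro sum_mono mult_left_mono assms(5))
      fix v assume v: "v \<in> V"
      then have "insert v (insert y (V - {v})) = insert y V" by auto
      then show "link_sum \<mu> (a + b) (V - {v}) v y + fork_sum \<mu> (Suc a) b (V - {v}) v y
          + fork_sum \<mu> a (Suc b) (V - {v}) v y \<le> (?r / real (Suc (a + b))) ^ Suc (a + b)"
        using Suc.hyps(1)[of a b "V - {v}" v y] k V v by auto
    qed
    also have "\<dots> \<le> ((?d + ?r) / real (Suc (Suc (a + b)))) ^ Suc (Suc (a + b))"
      unfolding sum_distrib_right[symmetric] by (intro power_mean_step d r) simp
    also have "\<dots> \<le> ((\<mu> {x, y} + ?d + ?r) / real (Suc (Suc (a + b)))) ^ Suc (Suc (a + b))"
      using d r assms(5)[of "{x, y}"] by (intro power_mono divide_right_mono) auto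
    finally show ?thesis unfolding mass .
  qed
  show ?case
  proof (cases i)
    case (Suc a)
    then show ?thesis using step[of a j V x y] Suc.hyps(2) Suc.prems by simp
  next
    case 0
    then obtain b where b: "j = Suc b" using Suc.hyps(2) by (cases j) auto
    \<comment> \<open>With \<open>i = 0\<close> the last fork has no edge at \<open>x\<close>, so
      the next vertex is revealed at \<open>y\<close>: the same step applies with the two ends
      exchanged.\<close>
    have "link_sum \<mu> (Suc (b + 0)) V y x + fork_sum \<mu> (Suc (Suc b)) 0 V y x + fork_sum \<mu> (Suc b) (Suc 0) V y x
      \<le> (edge_mass \<mu> (insert y (insert x V)) / real (Suc (Suc (b + 0)))) ^ Suc (Suc (b + 0))"
      using Suc.hyps(2) Suc.prems 0 b by (intro step) auto
    then show ?thesis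
      using 0 b by (simp add: link_sum_commute[of \<mu> _ V x y] fork_sum_commute[of \<mu> _ _ V x y] insert_commute add.commute
          add.left_commute)
  qed
qed

section \<open>Paths and cycles through a given edge\<close>

lemma path_edges_mem: "distinct l \<Longrightarrow> e \<in> path_edges l \<Longrightarrow> e \<subseteq> set l \<and> card e = 2"
  by (induction l rule: path_edges.induct) auto

lemma K_edges_eq: "K_edges n = {e. e \<subseteq> {..<n} \<and> card e = 2}"
  by (auto simp: K_edges_def card_2_iff)

lemma finite_K_edges: "finite (K_edges n)"
  by (rule finite_subset[of _ "Pow {..<n}"]) (auto simp: K_edges_eq)

text \<open>An image of lists identifies the two orientations of a path, so sums over it still count
  each subgraph once.\<close>

lemma path_subgraphs_eq: "path_subgraphs n k = path_edges ` distinct_lists k {..<n}"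
  unfolding path_subgraphs_def distinct_lists_def
  by (force simp: image_iff path_edges_nth[symmetric])

lemma cycle_subgraphs_eq:
  assumes "0 < m"
  shows "cycle_subgraphs n m = cycle_edges ` distinct_lists m {..<n}"
proof -
  have "{{vs ! i, vs ! ((i + 1) mod m)} | i. i < m} = cycle_edges vs" if "length vs = m" for vs :: "nat list"
    using cycle_edges_nth[of vs] that assms by auto
  then show ?thesis
    unfolding cycle_subgraphs_def distinct_lists_def by (auto simp: image_iff)
qed

lemma finite_path_subgraphs: "finite (path_subgraphs n k)"
  by (simp add: path_subgraphs_eq finite_distinct_lists)

lemma finite_cycle_subgraphs: "0 < m \<Longrightarrow> finite (cycle_subgraphs n m)"
  by (simp add: cycle_subgraphs_eq finite_distinct_lists)

lemma path_subgraphsD: "X \<in> path_subgraphs n (Suc k) \<Longrightarrow> X \<subseteq> K_edges n \<and> card X = k"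
  using path_edges_mem by (fastforce simp: path_subgraphs_eq distinct_lists_def card_path_edges K_edges_eq)

lemma cycle_edges_mem:
  assumes "distinct l" "2 \<le> length l" "e \<in> cycle_edges l"
  shows "e \<subseteq> set l \<and> card e = 2"
proof -
  obtain a l' where "l = a # l'" "l' \<noteq> []" using assms by (cases l) (auto simp: Suc_le_eq)
  moreover from this have "last l' \<noteq> a" using assms(1) last_in_set[of l'] by auto
  ultimately have "card {last l, hd l} = 2" "{last l, hd l} \<subseteq> set l" by auto
  then show ?thesis using assms(3) path_edges_mem[OF assms(1), of e] unfolding cycle_edges_def by blast
qed

lemma cycle_subgraphsD: "X \<in> cycle_subgraphs n m \<Longrightarrow> 3 \<le> m \<Longrightarrow> X \<subseteq> K_edges n \<and> card X = m"
  using cycle_edges_mem by (fastforce simp: cycle_subgraphs_eq distinct_lists_def card_cycle_edges K_edges_eq)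

text \<open>Rotation turns the given edge into the closing edge of the list, and a reversal, if
  necessary, puts \<open>x\<close> first and \<open>y\<close> last; deleting the closing edge then
  leaves the path along the list.\<close>

lemma cycle_minus_edge:
  assumes "3 \<le> m" "x \<noteq> y" "X \<in> cycle_edges ` distinct_lists m U" "{x, y} \<in> X"
  shows "\<exists>l\<in>distinct_lists (m - 2) (U - {x, y}). X - {{x, y}} = path_edges (x # l @ [y])"
proof -
  obtain vs where vs: "vs \<in> distinct_lists m U" "X = cycle_edges vs" using assms(3) by blast
  obtain ws where ws: "ws \<in> distinct_lists m U" "X = cycle_edges ws" "{last ws, hd ws} = {x, y}"
  proof (cases "{x, y} = {last vs, hd vs}")
    case True
    then show ?thesis using vs by (intro that[of vs]) auto
  next
    case False
    then have "{x, y} \<in> path_edges vs" using vs assms(4) by (auto simp: cycle_edges_def)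
    then obtain p q where pq: "vs = p @ q" "p \<noteq> []" "q \<noteq> []" "{x, y} = {last p, hd q}"
      using path_edges_split by blast
    then show ?thesis using vs
      by (intro that[of "q @ p"]) (auto simp: distinct_lists_def cycle_edges_swap[of p q])
  qed
  obtain zs where zs: "zs \<in> distinct_lists m U" "X = cycle_edges zs" "hd zs = x" "last zs = y"
  proof (cases "hd ws = x")
    case True
    then show ?thesis using ws assms(2) by (intro that[of ws]) (auto simp: doubleton_eq_iff)
  next
    case False
    then show ?thesis using ws assms(1,2)
      by (intro that[of "rev ws"])
        (auto simp: doubleton_eq_iff distinct_lists_def cycle_edges_rev hd_rev last_rev)
  qed
  have len: "length zs = m" and dist: "distinct zs" and sub: "set zs \<subseteq> U"
    using zs by (auto simp: distinct_lists_def)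
  obtain zs' where zs': "zs = x # zs'" using zs(3) len assms(1) by (cases zs) auto
  then have "zs' \<noteq> []" using len assms(1) by auto
  then obtain l where l: "zs = x # l @ [y]" using zs(4) zs' by (cases zs' rule: rev_cases) auto
  have "X - {{x, y}} = path_edges zs"
    using zs(2-4) last_hd_not_mem_path_edges[of zs] dist len assms(1)
    by (auto simp: cycle_edges_def insert_commute)
  moreover have "l \<in> distinct_lists (m - 2) (U - {x, y})"
    using len dist sub l by (auto simp: distinct_lists_def)
  ultimately show ?thesis using l by blast
qed

text \<open>The path is cut at the given edge and reversed if necessary, so that \<open>x\<close>
  ends the first half and \<open>y\<close> begins the second. The index \<open>i\<close> counts the
  vertices beyond \<open>x\<close>, and both remainders are stored in one list.\<close>

lemma path_minus_edge:
  assumes "x \<noteq> y" "X \<in> path_edges ` distinct_lists (Suc m) U" "{x, y} \<in> X"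
  shows "\<exists>i<m. \<exists>l\<in>distinct_lists (m - 1) (U - {x, y}).
    X - {{x, y}} = path_edges (x # take i l) \<union> path_edges (y # drop i l)"
proof -
  obtain vs where vs: "vs \<in> distinct_lists (Suc m) U" "X = path_edges vs" using assms(2) by blast
  obtain p q where pq: "vs = p @ q" "p \<noteq> []" "q \<noteq> []" "{x, y} = {last p, hd q}"
    using path_edges_split[of "{x, y}" vs] vs assms(3) by blast
  obtain p' q' where pq': "p' @ q' \<in> distinct_lists (Suc m) U" "X = path_edges (p' @ q')"
    "p' \<noteq> []" "q' \<noteq> []" "last p' = x" "hd q' = y"
  proof (cases "last p = x")
    case True
    then show ?thesis using that[of p q] pq vs by (auto simp: doubleton_eq_iff)
  next
    case False
    have "path_edges (rev q @ rev p) = X" using path_edges_rev[of vs] pq vs by simp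
    then show ?thesis using that[of "rev q" "rev p"] pq vs False
      by (auto simp: doubleton_eq_iff distinct_lists_def hd_rev last_rev)
  qed
  \<comment> \<open>The first half is read away from \<open>x\<close>, hence backwards, so that both
    remainders start at an end of the deleted edge.\<close>
  obtain a where a: "p' = rev a @ [x]"
    using pq'(3,5) by (metis append_butlast_last_id rev_rev_ident)
  obtain b where b: "q' = y # b" using pq'(4,6) by (cases q') auto
  have d: "distinct (a @ b)" "x \<notin> set (a @ b)" "y \<notin> set (a @ b)" "set (a @ b) \<subseteq> U" "length (a @ b) = m - 1"
    "length a < m"
    using pq'(1) a b by (auto simp: distinct_lists_def)
  have "path_edges p' = path_edges (x # a)" using path_edges_rev[of "x # a"] a by simp
  then have "X = insert {x, y} (path_edges (x # a) \<union> path_edges (y # b))"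
    using pq' b by (simp add: path_edges_append)
  moreover have "{y, x} \<notin> path_edges (x # a)" "{x, y} \<notin> path_edges (y # b)"
    using d assms(1) by (auto intro!: not_mem_path_edges)
  ultimately have "X - {{x, y}} = path_edges (x # a) \<union> path_edges (y # b)"
    by (auto simp: insert_commute)
  then show ?thesis using d
    by (intro exI[of _ "length a"] conjI bexI[of _ "a @ b"]) (auto simp: distinct_lists_def)
qed

text \<open>Deleting \<open>e\<close> is injective on sets that contain it, and repeated values of
  \<open>f\<close> only enlarge the right side because the weights are nonnegative. Hence only the
  existence of a representation has to be checked for each \<open>X\<close>.\<close>

lemma sum_prod_minus_le:
  assumes "finite I" "\<And>e. 0 \<le> \<mu> e"
    and "\<And>X. X \<in> \<X> \<Longrightarrow> e \<in> X \<and> (\<exists>i\<in>I. X - {e} = f i)"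
  shows "(\<Sum>X\<in>\<X>. prod \<mu> (X - {e})) \<le> (\<Sum>i\<in>I. prod (\<mu> :: 'a \<Rightarrow> real) (f i))"
proof -
  have "inj_on (\<lambda>X. X - {e}) \<X>" using assms(3) by (fastforce simp: inj_on_def)
  then have "(\<Sum>X\<in>\<X>. prod \<mu> (X - {e})) = (\<Sum>Z\<in>(\<lambda>X. X - {e}) ` \<X>. prod \<mu> Z)"
    by (simp add: sum.reindex)
  also have "\<dots> \<le> (\<Sum>Z\<in>f ` I. prod \<mu> Z)"
    using assms by (intro sum_mono2 finite_imageI prod_nonneg) (auto simp: image_iff)
  also have "\<dots> \<le> (\<Sum>i\<in>I. prod \<mu> (f i))"
    using sum_image_le[of I "prod \<mu>" f] assms by (simp add: prod_nonneg)
  finally show ?thesis .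
qed

lemma cycles_through_le_link_sum:
  assumes "finite U" "3 \<le> m" "x \<noteq> y" "\<And>e. 0 \<le> \<mu> e"
  shows "(\<Sum>X\<in>{X \<in> cycle_edges ` distinct_lists m U. {x, y} \<in> X}. prod \<mu> (X - {{x, y}}))
     \<le> link_sum \<mu> (m - 2) (U - {x, y}) x y"
proof -
  let ?I = "distinct_lists (m - 2) (U - {x, y})"
  have "(\<Sum>X\<in>{X \<in> cycle_edges ` distinct_lists m U. {x, y} \<in> X}. prod \<mu> (X - {{x, y}}))
      \<le> (\<Sum>l\<in>?I. prod \<mu> (path_edges (x # l @ [y])))"
  proof (rule sum_prod_minus_le)
    fix X assume "X \<in> {X \<in> cycle_edges ` distinct_lists m U. {x, y} \<in> X}"
    then show "{x, y} \<in> X \<and> (\<exists>l\<in>?I. X - {{x, y}} = path_edges (x # l @ [y]))"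
      using cycle_minus_edge[OF assms(2,3)] by blast
  qed (use assms in \<open>simp_all add: finite_distinct_lists\<close>)
  also have "\<dots> = link_sum \<mu> (m - 2) (U - {x, y}) x y"
    unfolding link_sum_def using assms
    by (intro sum.cong refl prod_path_edges) (auto simp: distinct_lists_def)
  finally show ?thesis .
qed

lemma paths_through_le_fork_sum:
  assumes "finite U" "x \<noteq> y" "\<And>e. 0 \<le> \<mu> e"
  shows "(\<Sum>X\<in>{X \<in> path_edges ` distinct_lists (Suc m) U. {x, y} \<in> X}. prod \<mu> (X - {{x, y}}))
     \<le> (\<Sum>i<m. fork_sum \<mu> i (m - 1 - i) (U - {x, y}) x y)"
proof -
  let ?I = "distinct_lists (m - 1) (U - {x, y})"
  let ?f = "\<lambda>i l. path_edges (x # take i l) \<union> path_edges (y # drop i l)"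
  have "(\<Sum>X\<in>{X \<in> path_edges ` distinct_lists (Suc m) U. {x, y} \<in> X}. prod \<mu> (X - {{x, y}}))
      \<le> (\<Sum>p\<in>{..<m} \<times> ?I. prod \<mu> (?f (fst p) (snd p)))"
  proof (rule sum_prod_minus_le)
    fix X assume X: "X \<in> {X \<in> path_edges ` distinct_lists (Suc m) U. {x, y} \<in> X}"
    then obtain i l where "i < m" "l \<in> ?I" "X - {{x, y}} = ?f i l"
      using path_minus_edge[OF assms(2), of X m U] by blast
    then show "{x, y} \<in> X \<and> (\<exists>p\<in>{..<m} \<times> ?I. X - {{x, y}} = ?f (fst p) (snd p))"
      using X by (intro conjI bexI[of _ "(i, l)"]) auto
  qed (use assms in \<open>simp_all add: finite_distinct_lists\<close>)
  also have "\<dots> = (\<Sum>i<m. \<Sum>l\<in>?I. prod \<mu> (?f i l))"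
    by (simp add: sum.cartesian_product case_prod_beta)
  also have "\<dots> = (\<Sum>i<m. fork_sum \<mu> i (m - 1 - i) (U - {x, y}) x y)"
  proof (intro sum.cong refl)
    fix i assume "i \<in> {..<m}"
    then have i: "i + (m - 1 - i) = m - 1" by auto
    show "(\<Sum>l\<in>?I. prod \<mu> (?f i l)) = fork_sum \<mu> i (m - 1 - i) (U - {x, y}) x y"
      unfolding fork_sum_def i
    proof (intro sum.cong refl)
      fix l assume l: "l \<in> ?I"
      then have "distinct (take i l @ drop i l)" "set (take i l @ drop i l) \<subseteq> U - {x, y}"
        by (simp_all add: distinct_lists_def)
      then have d: "distinct (x # take i l)" "distinct (y # drop i l)"
        "set (x # take i l) \<inter> set (y # drop i l) = {}"
        unfolding distinct_append set_append using assms(2) by auto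
      have "path_edges (x # take i l) \<inter> path_edges (y # drop i l) = {}"
      proof (rule equals0I)
        fix e assume e: "e \<in> path_edges (x # take i l) \<inter> path_edges (y # drop i l)"
        then have "e \<subseteq> set (x # take i l) \<inter> set (y # drop i l)" "card e = 2"
          using path_edges_mem[OF d(1)] path_edges_mem[OF d(2)] by blast+
        then show False using d(3) by (metis card.empty subset_empty zero_neq_numeral)
      qed
      then show "prod \<mu> (?f i l) = path_weight \<mu> (x # take i l) * path_weight \<mu> (y # drop i l)"
        using d by (simp add: prod.union_disjoint finite_path_edges prod_path_edges)
    qed
  qed
  finally show ?thesis .
qed

section \<open>Bounds on the objective\<close>

text \<open>With a sum of two indicators as coefficient, an overlap of \<open>A\<close> and
  \<open>B\<close> is counted correctly. Cycles and paths can thus be merged into one multilinear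
  form.\<close>

lemma sum_Un_weighted:
  fixes g :: "'a \<Rightarrow> real"
  assumes "finite A" "finite B"
  shows "(\<Sum>X\<in>A \<union> B. ((if X \<in> A then a else 0) + (if X \<in> B then b else 0)) * g X) = a * sum g A + b * sum g B"
proof -
  have "(\<Sum>X\<in>A \<union> B. (if X \<in> A then a else 0) * g X) = (\<Sum>X\<in>A. a * g X)"
    using assms by (intro sum.mono_neutral_cong_right) auto
  moreover have "(\<Sum>X\<in>A \<union> B. (if X \<in> B then b else 0) * g X) = (\<Sum>X\<in>B. b * g X)"
    using assms by (intro sum.mono_neutral_cong_right) auto
  ultimately show ?thesis by (simp add: distrib_right sum.distrib sum_distrib_left)
qed

text \<open>The terms are paired from the start. For odd \<open>m\<close> one term is left over and
  is bounded by \<open>B\<close> through the pair with its nonnegative predecessor; this causes the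
  rounding up.\<close>

lemma sum_le_of_consecutive:
  fixes D :: "nat \<Rightarrow> real"
  assumes "2 \<le> m" "\<And>i. i < m \<Longrightarrow> 0 \<le> D i" "\<And>i. Suc i < m \<Longrightarrow> D i + D (Suc i) \<le> B"
  shows "(\<Sum>i<m. D i) \<le> real ((m + 1) div 2) * B"
proof -
  have even: "(\<Sum>i<2 * h. D i) \<le> real h * B" if "2 * h \<le> m" for h
    using that
  proof (induction h)
    case (Suc h)
    then show ?case using assms(3)[of "2 * h"] by (simp add: algebra_simps)
  qed simp
  show ?thesis
  proof (cases "even m")
    case True
    then show ?thesis using even[of "m div 2"] by auto
  next
    case False
    then obtain h where h: "m = Suc (2 * h)" by (auto elim: oddE)
    with assms(1) obtain g where g: "h = Suc g" by (cases h) auto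
    have "D (2 * h) \<le> B" using assms(2)[of "Suc (2 * g)"] assms(3)[of "Suc (2 * g)"] h g by simp
    then show ?thesis using even[of h] h by (simp add: algebra_simps)
  qed
qed

section \<open>From the maximiser to an estimate in two real parameters\<close>

text \<open>The numbers \<open>t\<close> and \<open>S\<close> belong to a maximiser on
  \<open>K_edges n\<close> and not to \<open>\<nu>\<close>, which enters only through its smaller
  objective value. What remains afterwards is real analysis in \<open>t\<close> and
  \<open>S\<close>.\<close>

lemma objective_le:
  assumes m: "3 \<le> m" and \<nu>: "edge_prob_measure n \<nu>"
  obtains t S where "0 \<le> t" "t \<le> 1" "0 \<le> S"
    "S \<le> t * ((1 - t) / real (m - 1)) ^ (m - 2)" "S \<le> ((1 - t) / real (m - 1)) ^ (m - 1)"
    "2 * real m * beta_cycle n \<nu> m + beta_path n \<nu> (m + 1)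
      \<le> 2 * S + real ((m + 1) div 2) / real m * (((1 - t) / real (m - 1)) ^ (m - 1) - S)"
proof -
  let ?E = "K_edges n" and ?C = "cycle_subgraphs n m" and ?P = "path_subgraphs n (m + 1)"
  define c where "c = (\<lambda>X. (if X \<in> ?C then 2 * real m else 0) + (if X \<in> ?P then 1 else (0::real)))"
  define F where "F = (\<lambda>\<mu>. \<Sum>X\<in>?C \<union> ?P. c X * prod \<mu> X)"
  have fin: "finite ?C" "finite ?P" "finite ?E"
    using m by (simp_all add: finite_cycle_subgraphs finite_path_subgraphs finite_K_edges)
  have F_eq: "F \<mu> = 2 * real m * beta_cycle n \<mu> m + beta_path n \<mu> (m + 1)" for \<mu>
    using sum_Un_weighted[OF fin(1,2), of "2 * real m" 1 "prod \<mu>"]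
    by (simp add: F_def c_def beta_cycle_def beta_path_def mu_sub_def)
  have ne: "?E \<noteq> {}" using \<nu> by (auto simp: edge_prob_measure_def)
  have hom: "X \<subseteq> ?E \<and> card X = m" if "X \<in> ?C \<union> ?P" for X
    using that cycle_subgraphsD[of X n m] path_subgraphsD[of X n m] m by auto
  obtain \<mu> where \<mu>: "\<And>e. 0 \<le> \<mu> e" "\<And>e. e \<notin> ?E \<Longrightarrow> \<mu> e = 0" "sum \<mu> ?E = 1"
    and max: "\<And>\<nu>. (\<And>e. e \<in> ?E \<Longrightarrow> 0 \<le> \<nu> e) \<Longrightarrow> sum \<nu> ?E = 1 \<Longrightarrow> F \<nu> \<le> F \<mu>"
    and grad: "\<And>e. e \<in> ?E \<Longrightarrow> 0 < \<mu> e \<Longrightarrow>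
      real m * F \<mu> = (\<Sum>X\<in>{X\<in>?C \<union> ?P. e \<in> X}. c X * prod \<mu> (X - {e}))"
    using prod_sum_maximizer[OF F_def fin(3) ne _ hom] fin by blast
  obtain e where e: "e \<in> ?E" "\<And>f. f \<in> ?E \<Longrightarrow> \<mu> f \<le> \<mu> e"
    using finite_has_maximal[of "\<mu> ` ?E"] fin(3) ne by (fastforce simp: not_le)
  define t where "t = \<mu> e"
  have t_max: "\<mu> f \<le> t" for f using e(2)[of f] \<mu>(1,2) by (cases "f \<in> ?E") (auto simp: t_def)
  have t_pos: "0 < t"
  proof (rule ccontr)
    assume "\<not> 0 < t"
    then have "sum \<mu> ?E \<le> 0" using e(2) by (intro sum_nonpos) (force simp: t_def)
    then show False using \<mu>(3) by simp
  qed
  obtain x y where xy: "e = {x, y}" "x \<noteq> y" "x < n" "y < n" using e(1) by (auto simp: K_edges_def)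
  \<comment> \<open>Setting the weight of \<open>e\<close> to 0 leaves the products over
    \<open>X - {e}\<close> unchanged and reduces the total mass to \<open>1 - t\<close>, so the mass
    bounds apply with this smaller value.\<close>
  define \<kappa> where "\<kappa> = \<mu>(e := 0)"
  have \<kappa>: "0 \<le> \<kappa> f" "\<kappa> f \<le> t" for f using \<mu>(1) t_max t_pos by (auto simp: \<kappa>_def)
  have prod_\<kappa>: "prod \<mu> (X - {e}) = prod \<kappa> (X - {e})" for X
    by (intro prod.cong) (auto simp: \<kappa>_def)
  define V where "V = {..<n} - {x, y}"
  have V: "finite V" "x \<notin> V" "y \<notin> V" "insert x (insert y V) = {..<n}"
    using xy by (auto simp: V_def)
  have "sum \<kappa> ?E = sum \<kappa> (?E - {e})" using e(1) fin(3) by (simp add: sum.remove[of ?E e] \<kappa>_def)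
  also have "\<dots> = sum \<mu> (?E - {e})" by (intro sum.cong) (auto simp: \<kappa>_def)
  also have "\<dots> = 1 - t" using \<mu>(3) e(1) fin(3) by (simp add: sum.remove[of ?E e] t_def)
  finally have mass: "edge_mass \<kappa> (insert x (insert y V)) = 1 - t"
    by (simp add: V edge_mass_def K_edges_eq)
  define S where "S = link_sum \<kappa> (m - 2) V x y"
  define D where "D i = fork_sum \<kappa> i (m - 1 - i) V x y" for i
  define q where "q = (1 - t) / real (m - 1)"
  have S0: "0 \<le> S" unfolding S_def by (rule link_sum_nonneg) (rule \<kappa>)
  have D0: "0 \<le> D i" for i unfolding D_def by (rule fork_sum_nonneg) (rule \<kappa>)
  have S1: "S \<le> t * q ^ (m - 2)"
  proof -
    have "Suc (m - 2) = m - 1" using m by simp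
    then show ?thesis
      using link_sum_le_max[of V x y \<kappa> t "m - 2", OF V(1-3) xy(2) \<kappa>] by (simp only: mass S_def q_def)
  qed
  have SD: "S + D i + D (Suc i) \<le> q ^ (m - 1)" if "Suc i < m" for i
  proof -
    have "i + (m - 2 - i) = m - 2" "Suc (m - 2) = m - 1" "Suc (m - 2 - i) = m - 1 - i" "m - 1 - Suc i = m - 2 - i"
      using that by auto
    then show ?thesis
      using link_fork_sum_le[of V x y \<kappa> i "m - 2 - i", OF V(1-3) xy(2) \<kappa>(1)]
      by (simp only: mass S_def D_def q_def)
  qed
  have "(\<Sum>i<m. D i) \<le> real ((m + 1) div 2) * (q ^ (m - 1) - S)"
    using m D0 SD by (intro sum_le_of_consecutive) (auto simp: algebra_simps)
  moreover have "real m * F \<mu> \<le> 2 * real m * S + (\<Sum>i<m. D i)"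
  proof -
    let ?C' = "{X \<in> ?C. e \<in> X}" and ?P' = "{X \<in> ?P. e \<in> X}"
    have "real m * F \<mu> = (\<Sum>X\<in>?C' \<union> ?P'. c X * prod \<kappa> (X - {e}))"
    proof -
      have "{X \<in> ?C \<union> ?P. e \<in> X} = ?C' \<union> ?P'" by blast
      then show ?thesis using grad[OF e(1)] t_pos by (simp only: t_def prod_\<kappa>)
    qed
    also have "\<dots> = (\<Sum>X\<in>?C' \<union> ?P'. ((if X \<in> ?C' then 2 * real m else 0) + (if X \<in> ?P' then 1 else 0))
        * prod \<kappa> (X - {e}))"
      by (intro sum.cong) (auto simp: c_def)
    also have "\<dots> = 2 * real m * (\<Sum>X\<in>?C'. prod \<kappa> (X - {e})) + (\<Sum>X\<in>?P'. prod \<kappa> (X - {e}))"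
      using fin by (subst sum_Un_weighted) auto
    also have "\<dots> \<le> 2 * real m * S + (\<Sum>i<m. D i)"
    proof (intro add_mono mult_left_mono)
      show "(\<Sum>X\<in>?C'. prod \<kappa> (X - {e})) \<le> S"
        using cycles_through_le_link_sum[of "{..<n}" m x y \<kappa>] m xy \<kappa>(1)
        by (simp add: S_def V_def cycle_subgraphs_eq)
      show "(\<Sum>X\<in>?P'. prod \<kappa> (X - {e})) \<le> (\<Sum>i<m. D i)"
        using paths_through_le_fork_sum[of "{..<n}" x y \<kappa> m] xy \<kappa>(1)
        by (simp add: D_def V_def path_subgraphs_eq)
    qed simp
    finally show ?thesis .
  qed
  moreover have "2 * real m * S + real ((m + 1) div 2) * (q ^ (m - 1) - S)
      = real m * (2 * S + real ((m + 1) div 2) / real m * (q ^ (m - 1) - S))"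
    using m by (simp add: distrib_left)
  ultimately have "real m * F \<mu> \<le> real m * (2 * S + real ((m + 1) div 2) / real m * (q ^ (m - 1) - S))"
    by linarith
  then have "F \<mu> \<le> 2 * S + real ((m + 1) div 2) / real m * (q ^ (m - 1) - S)"
    using m by (simp add: mult_le_cancel_left_pos)
  moreover have "F \<nu> \<le> F \<mu>" using \<nu> by (intro max) (auto simp: edge_prob_measure_def)
  moreover have "t \<le> 1" using member_le_sum[of e ?E \<mu>] \<mu> e(1) fin(3) by (simp add: t_def)
  moreover have "S \<le> q ^ (m - 1)" using SD[of 0] D0[of 0] D0[of 1] m by simp
  ultimately show thesis
    using that[of t S] t_pos S0 S1 by (simp add: F_eq q_def)
qed

section \<open>Optimisation over the heaviest weight\<close>

lemma objective_le_3:
  assumes "edge_prob_measure n \<mu>"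
  shows "2 * real 3 * beta_cycle n \<mu> 3 + beta_path n \<mu> (3 + 1) \<le> 2 / real 3 ^ (3 - 1)"
proof -
  have "3 \<le> (3::nat)" by simp
  then obtain t S where t: "0 \<le> t" "t \<le> 1" and "0 \<le> S"
    and S: "S \<le> t * ((1 - t) / real (3 - 1)) ^ (3 - 2)" and "S \<le> ((1 - t) / real (3 - 1)) ^ (3 - 1)"
    and le: "2 * real 3 * beta_cycle n \<mu> 3 + beta_path n \<mu> (3 + 1)
      \<le> 2 * S + real ((3 + 1) div 2) / real 3 * (((1 - t) / real (3 - 1)) ^ (3 - 1) - S)"
    by (rule objective_le[OF _ assms])
  have "2 * S + real ((3 + 1) div 2) / real 3 * (((1 - t) / real (3 - 1)) ^ (3 - 1) - S)
      = 4 / 3 * S + (1 - t)\<^sup>2 / 6"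
    by (simp add: power2_eq_square field_simps)
  also have "\<dots> \<le> 4 / 3 * (t * (1 - t) / 2) + (1 - t)\<^sup>2 / 6" using S by simp
  \<comment> \<open>The double zero is at \<open>t = 1 / 3\<close>, the weight of each edge in the
    uniform triangle.\<close>
  also have "\<dots> = 2 / 9 - (1 - 3 * t)\<^sup>2 / 18" by (simp add: power2_eq_square field_simps)
  also have "\<dots> \<le> 2 / real 3 ^ (3 - 1)" by simp
  finally show ?thesis using le by linarith
qed

lemma objective_le_4:
  assumes "edge_prob_measure n \<mu>"
  shows "2 * real 4 * beta_cycle n \<mu> 4 + beta_path n \<mu> (4 + 1) \<le> 2 / real 4 ^ (4 - 1)"
proof -
  have "3 \<le> (4::nat)" by simp
  then obtain t S where t: "0 \<le> t" "t \<le> 1" and "0 \<le> S"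
    and S: "S \<le> t * ((1 - t) / real (4 - 1)) ^ (4 - 2)" and "S \<le> ((1 - t) / real (4 - 1)) ^ (4 - 1)"
    and le: "2 * real 4 * beta_cycle n \<mu> 4 + beta_path n \<mu> (4 + 1)
      \<le> 2 * S + real ((4 + 1) div 2) / real 4 * (((1 - t) / real (4 - 1)) ^ (4 - 1) - S)"
    by (rule objective_le[OF _ assms])
  have "2 * S + real ((4 + 1) div 2) / real 4 * (((1 - t) / real (4 - 1)) ^ (4 - 1) - S)
      = 3 / 2 * S + (1 - t) ^ 3 / 54"
    by (simp add: power3_eq_cube field_simps)
  also have "\<dots> \<le> 3 / 2 * (t * (1 - t)\<^sup>2 / 9) + (1 - t) ^ 3 / 54"
    using S by (simp add: power_divide)
  \<comment> \<open>The double zero is at \<open>t = 1 / 4\<close>, the uniform 4-cycle; the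
    cofactor is positive because \<open>t \<le> 1\<close>.\<close>
  also have "\<dots> = 1 / 32 - (1 - 4 * t)\<^sup>2 * (11 - 8 * t) / 864"
    by (simp add: power2_eq_square power3_eq_cube field_simps)
  also have "\<dots> \<le> 2 / real 4 ^ (4 - 1)" using t by simp
  finally show ?thesis using le by linarith
qed

lemma objective_le_ge_5:
  assumes m: "5 \<le> m" and \<mu>: "edge_prob_measure n \<mu>"
  shows "2 * real m * beta_cycle n \<mu> m + beta_path n \<mu> (m + 1) \<le> 2.5 / real m ^ (m - 1)"
proof -
  have "3 \<le> m" using m by simp
  then obtain t S where t: "0 \<le> t" "t \<le> 1" and S0: "0 \<le> S"
    and S1: "S \<le> t * ((1 - t) / real (m - 1)) ^ (m - 2)" and S2: "S \<le> ((1 - t) / real (m - 1)) ^ (m - 1)"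
    and le: "2 * real m * beta_cycle n \<mu> m + beta_path n \<mu> (m + 1)
      \<le> 2 * S + real ((m + 1) div 2) / real m * (((1 - t) / real (m - 1)) ^ (m - 1) - S)"
    by (rule objective_le[OF _ \<mu>])
  define k where "k = m - 2"
  define M where "M = real m"
  define q where "q = (1 - t) / (M - 1)"
  \<comment> \<open>Normalised so that the uniform \<open>m\<close>-cycle corresponds to
    \<open>z = 1\<close>.\<close>
  define z where "z = M * q"
  have mk: "m - 1 = Suc k" "m - 2 = k" "real k = M - 2" and M: "5 \<le> M" and rm: "real (Suc k) = M - 1"
    using m by (auto simp: k_def M_def)
  have q0: "0 \<le> q" using t M by (simp add: q_def)
  have z0: "0 \<le> z" using q0 M by (simp add: z_def)
  have tq: "t = 1 - (M - 1) * q" using M by (simp add: q_def)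
  have S1': "S \<le> t * q ^ k" and S2': "S \<le> q ^ Suc k"
    using S1 S2 by (simp_all only: mk(1,2) rm q_def)
  \<comment> \<open>Both parities are treated at once by a coefficient that is exact for odd
    \<open>m\<close>. Enlarging it is allowed because \<open>S \<le> q ^ Suc k\<close>.\<close>
  have "real ((m + 1) div 2) \<le> (M + 1) / 2"
  proof -
    have "real (2 * ((m + 1) div 2)) \<le> real (m + 1)" by (intro of_nat_mono) simp
    then show ?thesis by (simp add: M_def)
  qed
  then have "real ((m + 1) div 2) / M * (q ^ Suc k - S) \<le> (M + 1) / 2 / M * (q ^ Suc k - S)"
    using S2' M by (intro mult_right_mono divide_right_mono) auto
  then have "2 * real m * beta_cycle n \<mu> m + beta_path n \<mu> (m + 1)
      \<le> 2 * S + (M + 1) / 2 / M * (q ^ Suc k - S)"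
    using le by (simp only: mk(1) rm flip: q_def M_def)
  also have "\<dots> = (2 - (M + 1) / (2 * M)) * S + (M + 1) / (2 * M) * q ^ Suc k"
    using M by (simp add: field_simps)
  also have "\<dots> \<le> (2 - (M + 1) / (2 * M)) * (t * q ^ k) + (M + 1) / (2 * M) * q ^ Suc k"
    using S1' M by (intro add_mono mult_left_mono) (auto simp: field_simps)
  also have "\<dots> = q ^ k * (((3 * M - 1) - (3 * M - 5) * z) / (2 * M))"
    unfolding tq z_def using M by (simp add: field_simps)
  finally have "M ^ Suc k * (2 * real m * beta_cycle n \<mu> m + beta_path n \<mu> (m + 1))
      \<le> M ^ Suc k * (q ^ k * (((3 * M - 1) - (3 * M - 5) * z) / (2 * M)))"
    using M by (intro mult_left_mono) auto
  also have "\<dots> = z ^ k * ((3 * M - 1) - (3 * M - 5) * z) / 2"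
    unfolding z_def using M by (simp add: field_simps)
  also have "\<dots> \<le> 2.5"
  proof -
    txt \<open>The tangent bound \<open>1 + u \<le> exp u\<close> is used with the slope \<open>c\<close> for which the exponentials in \<open>s\<close> cancel.\<close>
    define c where "c = (3 * M - 5) / (M - 2)"
    define s where "s = z - 1"
    \<comment> \<open>Since \<open>c = 3 + 1 / (M - 2)\<close>, the upper bound is the value at
      \<open>M = 5\<close> and the lower bound is the limit for large \<open>M\<close>.\<close>
    have c: "0 < c" "3 \<le> c" "c \<le> 10 / 3" using M by (auto simp: c_def field_simps)
    have "3 * M - 5 = c * (M - 2)" using M by (simp add: c_def)
    moreover have "(3 * M - 1) - (3 * M - 5) * z = 4 - (3 * M - 5) * s"
      by (simp add: s_def algebra_simps)
    ultimately have "(3 * M - 1) - (3 * M - 5) * z = 4 - c * ((M - 2) * s)"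
      by (simp add: mult.assoc)
    also have "\<dots> = c * (1 + (4 / c - 1 - (M - 2) * s))"
      using c by (simp add: algebra_simps)
    also have "\<dots> \<le> c * exp (4 / c - 1 - (M - 2) * s)"
      using c by (intro mult_left_mono exp_ge_add_one_self) auto
    finally have "z ^ k * ((3 * M - 1) - (3 * M - 5) * z) \<le> z ^ k * (c * exp (4 / c - 1 - (M - 2) * s))"
      using z0 by (intro mult_left_mono) auto
    also have "\<dots> \<le> exp s ^ k * (c * exp (4 / c - 1 - (M - 2) * s))"
      using z0 c exp_ge_add_one_self[of s] by (intro mult_right_mono power_mono) (auto simp: s_def)
    also have "\<dots> = c * exp (4 / c - 1)"
      by (simp add: mk(3) flip: exp_of_nat_mult exp_add)
    also have "\<dots> \<le> 10 / 3 * exp (1 / 3)"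
      using c by (intro mult_mono) (auto simp: field_simps)
    \<comment> \<open>Cubing reduces the estimate to e \<le> 3 \<le> 27/8. The product is 5, and the
      factor 1/2 set aside above turns it into 2.5.\<close>
    also have "\<dots> \<le> 10 / 3 * (3 / 2)"
    proof -
      have "exp (1 / 3 :: real) ^ 3 = exp 1" by (simp flip: exp_of_nat_mult)
      also have "\<dots> \<le> (3 / 2) ^ 3" using exp_le by (simp add: power3_eq_cube)
      finally have "exp (1 / 3 :: real) \<le> 3 / 2" using power_mono_iff[of "exp (1 / 3 :: real)" "3 / 2" 3] by simp
      then show ?thesis by simp
    qed
    finally show ?thesis by simp
  qed
  finally have "(2 * real m * beta_cycle n \<mu> m + beta_path n \<mu> (m + 1)) * M ^ Suc k \<le> 2.5"
    by (simp only: mult.commute)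
  moreover have "0 < M ^ Suc k" using M by simp
  ultimately show ?thesis by (simp only: mk(1) pos_le_divide_eq flip: M_def)
qed

section \<open>Extremal measures\<close>

lemma edge_prob_measure_uniform:
  assumes "X \<subseteq> K_edges n" "X \<noteq> {}"
  shows "edge_prob_measure n (\<lambda>e. if e \<in> X then 1 / real (card X) else 0)"
proof -
  have "finite X" using assms(1) finite_K_edges by (rule finite_subset)
  have "(\<Sum>e\<in>K_edges n. if e \<in> X then 1 / real (card X) else 0) = (\<Sum>e\<in>X. 1 / real (card X))"
    using assms(1) finite_K_edges by (intro sum.mono_neutral_cong_right) auto
  also have "\<dots> = 1" using assms(2) \<open>finite X\<close> by simp
  finally show ?thesis by (simp add: edge_prob_measure_def)
qed

lemma mu_sub_nonneg:
  "edge_prob_measure n \<mu> \<Longrightarrow> X \<subseteq> K_edges n \<Longrightarrow> 0 \<le> mu_sub \<mu> X"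
  unfolding mu_sub_def edge_prob_measure_def by (intro prod_nonneg) auto

lemma beta_path_nonneg: "edge_prob_measure n \<mu> \<Longrightarrow> 0 \<le> beta_path n \<mu> (Suc k)"
  unfolding beta_path_def by (intro sum_nonneg mu_sub_nonneg) (auto dest: path_subgraphsD)

text \<open>For the uniform measure on one \<open>m\<close>-cycle, that cycle alone contributes 2m
  (1/m)^m = 2/m^{m-1}, and all other terms are nonnegative.\<close>

lemma objective_cycle_ge:
  assumes "3 \<le> m"
  shows "\<exists>n \<mu>. edge_prob_measure n \<mu> \<and>
    2 / real m ^ (m - 1) \<le> 2 * real m * beta_cycle n \<mu> m + beta_path n \<mu> (m + 1)"
proof -
  define X where "X = cycle_edges [0..<m]"
  define \<mu> where "\<mu> = (\<lambda>e. if e \<in> X then 1 / real (card X) else 0)"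
  have X: "X \<in> cycle_subgraphs m m"
    using assms by (auto simp: X_def cycle_subgraphs_eq distinct_lists_def)
  then have sub: "X \<subseteq> K_edges m" and card: "card X = m" using cycle_subgraphsD assms by blast+
  have \<mu>: "edge_prob_measure m \<mu>"
    unfolding \<mu>_def using sub card assms by (intro edge_prob_measure_uniform) auto
  have "(1 / real m) ^ m = mu_sub \<mu> X" by (simp add: mu_sub_def \<mu>_def card)
  also have "\<dots> \<le> beta_cycle m \<mu> m"
    unfolding beta_cycle_def using X assms cycle_subgraphsD[of _ m m]
    by (intro member_le_sum mu_sub_nonneg[OF \<mu>] finite_cycle_subgraphs) auto
  finally have "2 * real m * (1 / real m) ^ m \<le> 2 * real m * beta_cycle m \<mu> m"
    by (intro mult_left_mono) auto
  moreover have "2 * real m * (1 / real m) ^ m = 2 / real m ^ (m - 1)"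
    using assms by (cases m) (auto simp: power_one_over simp del: of_nat_Suc)
  ultimately have "2 / real m ^ (m - 1) \<le> 2 * real m * beta_cycle m \<mu> m + beta_path m \<mu> (m + 1)"
    using beta_path_nonneg[OF \<mu>, of m] by simp
  then show ?thesis using \<mu> by blast
qed

section \<open>The case of squares and P_3\<close>

text \<open>The squared total mass 1 is the diagonal sum plus the sum over ordered pairs of distinct
  edges. The latter dominates the P_3 term even though adjacency is dropped and each pair is counted
  twice, so the objective is at most twice the diagonal plus once the off-diagonal part.\<close>

lemma path3_objective_le:
  assumes \<mu>: "edge_prob_measure n \<mu>"
  shows "2 * (\<Sum>e\<in>supp_mu n \<mu>. (\<mu> e)^2) + beta_path n \<mu> 3 \<le> 2"
proof -
  let ?E = "K_edges n"
  let ?I = "{p \<in> ?E \<times> ?E. fst p \<noteq> snd p}"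
  have nn: "0 \<le> \<mu> e" if "e \<in> ?E" for e using \<mu> that by (auto simp: edge_prob_measure_def)
  have "beta_path n \<mu> 3 \<le> (\<Sum>X\<in>(\<lambda>p. {fst p, snd p}) ` ?I. mu_sub \<mu> X)"
    unfolding beta_path_def
  proof (intro sum_mono2 finite_imageI mu_sub_nonneg[OF \<mu>])
    show "finite ?I" using finite_K_edges by simp
    show "path_subgraphs n 3 \<subseteq> (\<lambda>p. {fst p, snd p}) ` ?I"
    proof
      fix X assume "X \<in> path_subgraphs n 3"
      then have "X \<subseteq> ?E" "card X = 2" using path_subgraphsD[of X n 2] by (auto simp: numeral_3_eq_3 numeral_2_eq_2)
      then show "X \<in> (\<lambda>p. {fst p, snd p}) ` ?I"
        by (auto simp: card_2_iff image_iff)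
    qed
  qed auto
  also have "\<dots> \<le> (\<Sum>p\<in>?I. mu_sub \<mu> {fst p, snd p})"
    by (rule order_trans[OF sum_image_le])
      (use finite_K_edges nn in \<open>auto simp: mu_sub_def\<close>)
  also have "\<dots> = (\<Sum>p\<in>?I. \<mu> (fst p) * \<mu> (snd p))"
    by (intro sum.cong) (auto simp: mu_sub_def)
  finally have path: "beta_path n \<mu> 3 \<le> (\<Sum>p\<in>?I. \<mu> (fst p) * \<mu> (snd p))" .
  have "(\<Sum>e\<in>supp_mu n \<mu>. (\<mu> e)^2) = (\<Sum>e\<in>?E. (\<mu> e)^2)"
    using nn finite_K_edges by (intro sum.mono_neutral_left) (force simp: supp_mu_def)+
  also have "\<dots> = (\<Sum>p\<in>(\<lambda>e. (e, e)) ` ?E. \<mu> (fst p) * \<mu> (snd p))"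
    by (subst sum.reindex) (auto simp: inj_on_def power2_eq_square)
  finally have sq: "(\<Sum>e\<in>supp_mu n \<mu>. (\<mu> e)^2) = (\<Sum>p\<in>(\<lambda>e. (e, e)) ` ?E. \<mu> (fst p) * \<mu> (snd p))" .
  have "1 = (\<Sum>e\<in>?E. \<mu> e) * (\<Sum>e\<in>?E. \<mu> e)" using \<mu> by (simp add: edge_prob_measure_def)
  also have "\<dots> = (\<Sum>p\<in>?E \<times> ?E. \<mu> (fst p) * \<mu> (snd p))"
    by (simp add: sum_product sum.cartesian_product case_prod_beta)
  also have "?E \<times> ?E = (\<lambda>e. (e, e)) ` ?E \<union> ?I" by auto
  also have "(\<Sum>p\<in>(\<lambda>e. (e, e)) ` ?E \<union> ?I. \<mu> (fst p) * \<mu> (snd p))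
      = (\<Sum>p\<in>(\<lambda>e. (e, e)) ` ?E. \<mu> (fst p) * \<mu> (snd p)) + (\<Sum>p\<in>?I. \<mu> (fst p) * \<mu> (snd p))"
    using finite_K_edges by (intro sum.union_disjoint) auto
  finally have "(\<Sum>e\<in>supp_mu n \<mu>. (\<mu> e)^2) + (\<Sum>p\<in>?I. \<mu> (fst p) * \<mu> (snd p)) = 1"
    using sq by simp
  moreover have "0 \<le> (\<Sum>p\<in>?I. \<mu> (fst p) * \<mu> (snd p))" using nn by (intro sum_nonneg) auto
  ultimately show ?thesis using path by linarith
qed

text \<open>All the mass is put on a single edge, for which the sum of squares is already 1.\<close>

lemma path3_objective_ge:
  "\<exists>n \<mu>. edge_prob_measure n \<mu> \<and> 2 \<le> 2 * (\<Sum>e\<in>supp_mu n \<mu>. (\<mu> e)^2) + beta_path n \<mu> 3"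
proof -
  let ?X = "{{0, 1::nat}}"
  define \<mu> where "\<mu> = (\<lambda>e. if e \<in> ?X then 1 / real (card ?X) else 0)"
  have sub: "?X \<subseteq> K_edges 2" by (auto simp: K_edges_eq)
  then have \<mu>: "edge_prob_measure 2 \<mu>"
    unfolding \<mu>_def by (intro edge_prob_measure_uniform) auto
  have "supp_mu 2 \<mu> = ?X" using sub by (auto simp: supp_mu_def \<mu>_def)
  then have "(\<Sum>e\<in>supp_mu 2 \<mu>. (\<mu> e)^2) = 1" by (simp add: \<mu>_def)
  then have "2 \<le> 2 * (\<Sum>e\<in>supp_mu 2 \<mu>. (\<mu> e)^2) + beta_path 2 \<mu> 3"
    using beta_path_nonneg[OF \<mu>, of 2] by (simp add: numeral_3_eq_3 numeral_2_eq_2)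
  then show ?thesis using \<mu> by blast
qed

text \<open>\<open>Sup\<close> on the reals is informative only for nonempty sets that are bounded
  above, so boundedness is recorded with the value. The bound is attained and hence a
  maximum.\<close>

lemma bdd_above_and_Sup_eq:
  fixes A :: "real set"
  assumes "\<And>a. a \<in> A \<Longrightarrow> a \<le> b" "\<exists>a\<in>A. b \<le> a"
  shows "bdd_above A \<and> Sup A = b"
proof -
  have "b \<in> A" using assms by (metis antisym)
  then show ?thesis using assms(1) cSup_eq_maximum[of b A] by (auto simp: bdd_above_def)
qed

theorem theorem1p6:
  shows "(bdd_above {2 * (\<Sum>e\<in>supp_mu n \<mu>. (\<mu> e)^2) + beta_path n \<mu> 3 | n \<mu>. edge_prob_measure n \<mu>}
       \<and> Sup {2 * (\<Sum>e\<in>supp_mu n \<mu>. (\<mu> e)^2) + beta_path n \<mu> 3 | n \<mu>. edge_prob_measure n \<mu>} = 2)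
    \<and> (\<forall>m::nat. m \<in> {3, 4} \<longrightarrow>
       bdd_above {2 * real m * beta_cycle n \<mu> m + beta_path n \<mu> (m + 1) | n \<mu>. edge_prob_measure n \<mu>}
       \<and> Sup {2 * real m * beta_cycle n \<mu> m + beta_path n \<mu> (m + 1) | n \<mu>. edge_prob_measure n \<mu>}
           = 2 / real m ^ (m - 1))
    \<and> (\<forall>m::nat. 5 \<le> m \<longrightarrow>
       bdd_above {2 * real m * beta_cycle n \<mu> m + beta_path n \<mu> (m + 1) | n \<mu>. edge_prob_measure n \<mu>}
       \<and> Sup {2 * real m * beta_cycle n \<mu> m + beta_path n \<mu> (m + 1) | n \<mu>. edge_prob_measure n \<mu>}
           < 2.7 / real m ^ (m - 1))"
proof (rule conjI[OF _ conjI[OF allI[OF impI] allI[OF impI]]])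
  show "bdd_above {2 * (\<Sum>e\<in>supp_mu n \<mu>. (\<mu> e)^2) + beta_path n \<mu> 3 | n \<mu>. edge_prob_measure n \<mu>}
       \<and> Sup {2 * (\<Sum>e\<in>supp_mu n \<mu>. (\<mu> e)^2) + beta_path n \<mu> 3 | n \<mu>. edge_prob_measure n \<mu>} = 2"
    by (rule bdd_above_and_Sup_eq) (use path3_objective_le path3_objective_ge in blast)+
next
  fix m :: nat
  let ?A = "{2 * real m * beta_cycle n \<mu> m + beta_path n \<mu> (m + 1) | n \<mu>. edge_prob_measure n \<mu>}"
  assume m: "m \<in> {3, 4}"
  show "bdd_above ?A \<and> Sup ?A = 2 / real m ^ (m - 1)"
  proof (rule bdd_above_and_Sup_eq)
    show "a \<le> 2 / real m ^ (m - 1)" if "a \<in> ?A" for a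
      using that m objective_le_3 objective_le_4 by blast
    have "3 \<le> m" using m by auto
    then show "\<exists>a\<in>?A. 2 / real m ^ (m - 1) \<le> a"
      using objective_cycle_ge[of m] by blast
  qed
next
  fix m :: nat
  let ?A = "{2 * real m * beta_cycle n \<mu> m + beta_path n \<mu> (m + 1) | n \<mu>. edge_prob_measure n \<mu>}"
  assume m: "5 \<le> m"
  \<comment> \<open>A strict bound on each element would not survive the supremum; the gap between
    2.5 and 2.7 keeps the final inequality strict.\<close>
  have le: "a \<le> 2.5 / real m ^ (m - 1)" if "a \<in> ?A" for a
    using that objective_le_ge_5[OF m] by blast
  have "?A \<noteq> {}" using objective_cycle_ge[of m] m by fastforce
  then have "Sup ?A \<le> 2.5 / real m ^ (m - 1)" using le by (rule cSup_least)
  also have "\<dots> < 2.7 / real m ^ (m - 1)" using m by (intro divide_strict_right_mono) auto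
  finally show "bdd_above ?A \<and> Sup ?A < 2.7 / real m ^ (m - 1)"
    using le by (auto simp only: bdd_above_def)
qed

end
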